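(* Let $p,k\in\mathbb{N}=\{1,2,\ldots\}$, $0\le\gamma<p$, and let $f\in\mathcal{K}_s^{(k)}(\gamma,p)$. Then for every $z$ with $|z|=r$, $0\le r<1$: (i) $$\frac{[p-(p-2\gamma)r]\,r^{p-1}}{(1+r)^{2p+1}}\le|f'(z)|\le\frac{[p+(p-2\gamma)r]\,r^{p-1}}{(1-r)^{2p+1}};$$ (ii) $$\int_0^r\frac{[p-(p-2\gamma)\tau]\,\tau^{p-1}}{(1+\tau)^{2p+1}}\,d\tau\le|f(z)|\le\int_0^r\frac{[p+(p-2\gamma)\tau]\,\tau^{p-1}}{(1-\tau)^{2p+1}}\,d\tau.$$
   Context: $\mathbb{U}=\{z\in\mathbb{C}:|z|<1\}$. For $p\in\mathbb{N}$, $\mathcal{A}_p$ is the class of functions analytic in $\mathbb{U}$ of the form $f(z)=z^p+\sum_{n=1}^\infty a_{n+p}z^{n+p}$. Quotients below are understood with the removable singularity at $z=0$ filled in. For $0\le\alpha<p$, $\mathcal{S}_p^*(\alpha)$ is the class of $f\in\mathcal{A}_p$ with $\Re\left(zf'(z)/f(z)\right)>\alpha$ for all $z\in\mathbb{U}$. For $k\in\mathbb{N}$ and a function $g\in\mathcal{A}_p$, put $g_k(z)=\prod_{\nu=0}^{k-1}\varepsilon^{-\nu p}g(\varepsilon^\nu z)$ with $\varepsilon=e^{2\pi i/k}$. For $0\le\gamma<p$, $\mathcal{K}_s^{(k)}(\gamma,p)$ is the class of $f\in\mathcal{A}_p$ for which there exists $g\in\mathcal{S}_p^*\left(\frac{(k-1)p}{k}\right)$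 such that $\Re\left(\frac{z^{(k-1)p+1}f'(z)}{g_k(z)}\right)>\gamma$ for all $z\in\mathbb{U}$. The convention $0^0=1$ is used when $p=1$, $r=0$. *)

theory Defs
  imports "HOL-Complex_Analysis.Complex_Analysis"
begin

definition fill0 :: "(complex \<Rightarrow> complex) \<Rightarrow> complex \<Rightarrow> complex" where
  "fill0 h = h(0 := Lim (at 0) h)"

definition class_A :: "nat \<Rightarrow> (complex \<Rightarrow> complex) set" where
  "class_A p = {f. f analytic_on ball 0 1 \<and>
     (\<exists>a :: nat \<Rightarrow> complex. \<forall>z\<in>ball 0 1.
        (\<lambda>n. a (Suc n + p) * z ^ (Suc n + p)) sums (f z - z ^ p))}"

(* For \<alpha> \<ge> 0 the inequality excludes zeros of f in the punctured disc, since w / 0 = 0. *)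
definition starlike_class :: "nat \<Rightarrow> real \<Rightarrow> (complex \<Rightarrow> complex) set" where
  "starlike_class p \<alpha> = {f \<in> class_A p.
     \<forall>z\<in>ball 0 1. Re (fill0 (\<lambda>w. w * deriv f w / f w) z) > \<alpha>}"

definition sym_prod :: "nat \<Rightarrow> nat \<Rightarrow> (complex \<Rightarrow> complex) \<Rightarrow> complex \<Rightarrow> complex" where
  "sym_prod p k g z = (let \<epsilon> = exp (2 * of_real pi * \<i> / of_nat k)
     in \<Prod>\<nu><k. \<epsilon> powi (- int (\<nu> * p)) * g (\<epsilon> ^ \<nu> * z))"

definition class_K :: "nat \<Rightarrow> real \<Rightarrow> nat \<Rightarrow> (complex \<Rightarrow> complex) set" where
  "class_K k \<gamma> p = {f \<in> class_A p.
     \<exists>g \<in> starlike_class p ((real k - 1) * real p / real k). \<forall>z\<in>ball 0 1.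
        Re (fill0 (\<lambda>w. w ^ ((k - 1) * p + 1) * deriv f w / sym_prod p k g w) z) > \<gamma>}"

end

theory Submission
  imports Defs
begin

text \<open>
  Dividing \<open>g\<^sub>k\<close> by \<open>z\<^bsup>(k-1)p\<^esup>\<close> gives a \<open>p\<close>-valently starlike \<open>G = z\<^sup>p exp v\<close>, so
  \<open>h = z f' / G\<close> satisfies \<open>Re h > \<gamma>\<close> and \<open>h 0 = p\<close>. Schwarz's lemma bounds \<open>h\<close> and \<open>z G' / G\<close>;
  integrating the latter radially bounds \<open>G\<close>, and together these give (i) and, by integration along
  a radius, the upper half of (ii).

  The lower half of (ii) rests on \<open>p\<close>-valence. For \<open>q = (f - a) / G\<close> one has
  \<open>z q' / q = h / q - z G' / G\<close>, whose real part is negative wherever \<open>q\<close> is a negative real. So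
  on a circle \<open>q\<close> crosses the negative axis in one direction only, its winding number is at most
  \<open>0\<close>, and \<open>f - a\<close> has at most \<open>p\<close> zeros inside. Hence at a minimum of \<open>|f|\<close> on a circle the
  number \<open>z f' / f\<close>, which is real there, cannot be negative: otherwise values smaller than the
  minimum, already taken \<open>p\<close> times inside, would be taken again outside. At such points \<open>|f|\<close>
  therefore grows radially at the full rate \<open>|f'|\<close>.
\<close>


subsection \<open>Winding of curves crossing the negative axis in one direction\<close>

text \<open>If \<open>m\<close> were positive, \<open>B\<close> would have to climb past some level
  \<open>pi + 2 * pi * j\<close>. After the last time at or below that level it stays above it,
  which a negative derivative at that time forbids.\<close>

lemma no_upward_crossing:
  fixes B B' :: "real \<Rightarrow> real" and m :: int
  assumes der: "\<And>t. t \<in> {0..1} \<Longrightarrow> (B has_real_derivative B' t) (at t within {0..1})"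
    and neg: "\<And>t j. t \<in> {0..1} \<Longrightarrow> B t = pi + 2 * pi * of_int j \<Longrightarrow> B' t < 0"
    and ends: "B 1 = B 0 + 2 * pi * of_int m"
  shows "m \<le> 0"
proof (rule ccontr)
  assume "\<not> m \<le> 0"
  then have "real_of_int m \<ge> 1" by linarith
  then have B1: "B 1 \<ge> B 0 + 2 * pi"
    using mult_left_mono[of 1 "real_of_int m" "2 * pi"] unfolding ends by simp
  \<comment> \<open>\<open>c\<close> is the lowest critical level not below \<open>B 0\<close>. It
    is less than \<open>B 0 + 2 * pi\<close>, hence less than \<open>B 1\<close>.\<close>
  define j where "j = \<lceil>(B 0 - pi) / (2 * pi)\<rceil>"
  define c where "c = pi + 2 * pi * of_int j"
  have "(B 0 - pi) / (2 * pi) \<le> of_int j" "of_int j < (B 0 - pi) / (2 * pi) + 1"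
    unfolding j_def by linarith+
  then have c: "B 0 \<le> c" "c < B 1"
    using B1 pi_gt_zero unfolding c_def by (auto simp: field_simps)
  have cont: "continuous_on {0..1} B"
    using der DERIV_continuous_on by blast
  \<comment> \<open>The greatest element \<open>s\<close> of this compact set is the last time at
    which \<open>B\<close> is at most \<open>c\<close>.\<close>
  define S where "S = {t \<in> {0..1}. B t \<le> c}"
  have "S = {0..1} \<inter> B -` {..c}" unfolding S_def by auto
  then have "compact S"
    using continuous_closed_preimage[OF cont closed_atLeastAtMost closed_atMost, of c]
    by (auto simp: compact_eq_bounded_closed intro: bounded_subset[OF bounded_closed_interval[of 0 1]])
  moreover have "S \<noteq> {}" using c unfolding S_def by force
  ultimately obtain s where s: "s \<in> S" "\<And>t. t \<in> S \<Longrightarrow> t \<le> s"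
    using compact_attains_sup[of S] by auto
  have s01: "s \<in> {0..1}" and "B s \<le> c" "s < 1"
    using s(1) c unfolding S_def by (auto simp: less_le)
  have above: "B t > c" if "s < t" "t \<le> 1" for t
    using s(2)[of t] that s01 unfolding S_def by force
  have "B s = c"
  proof (rule ccontr)
    assume "B s \<noteq> c"
    have "continuous_on {s..1} B" using cont s01 continuous_on_subset by fastforce
    then obtain t where "s \<le> t" "t \<le> 1" "B t = c"
      using IVT'[of B s c 1] \<open>B s \<le> c\<close> c \<open>s < 1\<close> by auto
    with above[of t] \<open>B s \<noteq> c\<close> show False by (cases "t = s") auto
  qed
  then have "B' s < 0" using neg[of s j] s01 c_def by simp
  from has_real_derivative_neg_dec_right[OF der[OF s01] this]
  obtain d where d: "d > 0" "\<And>h. h > 0 \<Longrightarrow> s + h \<in> {0..1} \<Longrightarrow> h < d \<Longrightarrow> B (s + h) < B s"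
    by auto
  define h where "h = min (d / 2) (1 - s)"
  have "h > 0" "h < d" "s + h \<le> 1" using d(1) \<open>s < 1\<close> unfolding h_def by auto
  with d(2)[of h] above[of "s + h"] s01 \<open>B s = c\<close> show False by auto
qed

text \<open>Here \<open>d\<close> is the logarithmic derivative of \<open>q\<close>, so
  \<open>m\<close> is the net number of turns of \<open>q\<close> about 0. A continuous argument of
  \<open>q\<close> along the circle has derivative \<open>2 * pi * Re (z * d z)\<close>, which is
  negative whenever the argument is an odd multiple of pi; \<open>no_upward_crossing\<close> applies
  to it.\<close>

lemma circle_index_nonpos:
  fixes q d :: "complex \<Rightarrow> complex" and m :: int
  assumes "\<rho> > 0"
    and contd: "continuous_on (sphere 0 \<rho>) d"
    and der: "\<And>z. z \<in> sphere 0 \<rho> \<Longrightarrow> (q has_field_derivative d z * q z) (at z)"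
    and nz: "q (of_real \<rho>) \<noteq> 0"
    and neg: "\<And>z. z \<in> sphere 0 \<rho> \<Longrightarrow> q z \<in> \<real>\<^sub>\<le>\<^sub>0 \<Longrightarrow> Re (z * d z) < 0"
    and int: "contour_integral (circlepath 0 \<rho>) d = 2 * of_real pi * \<i> * of_int m"
  shows "m \<le> 0"
proof -
  define \<gamma> where "\<gamma> = circlepath 0 \<rho>"
  have \<gamma>: "\<gamma> t = of_real \<rho> * exp (2 * of_real pi * \<i> * of_real t)" for t
    by (simp add: \<gamma>_def circlepath)
  have sph: "\<gamma> t \<in> sphere 0 \<rho>" for t
    using \<open>\<rho> > 0\<close> by (simp add: \<gamma> norm_mult norm_exp_eq_Re)
  define w where "w = (\<lambda>t. 2 * of_real pi * \<i> * (\<gamma> t * d (\<gamma> t)))"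
  have d\<gamma>: "(\<gamma> has_vector_derivative 2 * of_real pi * \<i> * \<gamma> t) (at t within X)" for t X
    unfolding \<gamma>_def
    by (rule has_vector_derivative_eq_rhs[OF has_vector_derivative_circlepath]) (simp add: circlepath)
  have cont\<gamma>: "continuous_on X \<gamma>" for X
    by (rule continuous_on_vector_derivative[OF d\<gamma>])
  have "continuous_on {0..1} (\<lambda>t. d (\<gamma> t))"
    by (rule continuous_on_compose2[OF contd cont\<gamma>]) (use sph in auto)
  then have contw: "continuous_on {0..1} w"
    unfolding w_def by (intro continuous_intros cont\<gamma>)
  \<comment> \<open>A continuous logarithm of \<open>q\<close> along the circle: a starting value
    plus the integral of the logarithmic derivative. It is confirmed below by showing that
    \<open>exp (- L t) * q (\<gamma> t)\<close> has derivative 0 and starts at 1.\<close>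
  define L where "L = (\<lambda>t. Ln (q (of_real \<rho>)) + integral {0..t} w)"
  have dL: "(L has_vector_derivative w t) (at t within {0..1})" if "t \<in> {0..1}" for t
    unfolding L_def
    by (rule has_vector_derivative_eq_rhs[OF has_vector_derivative_add[OF has_vector_derivative_const 
          integral_has_vector_derivative[OF contw that]]]) simp
  have expL: "exp (L t) = q (\<gamma> t)" if t: "t \<in> {0..1}" for t
  proof -
    have "((\<lambda>t. exp (- L t) * q (\<gamma> t)) has_vector_derivative 0) (at t within {0..1})"
      if t: "t \<in> {0..1}" for t
    proof -
      have 1: "((q \<circ> \<gamma>) has_vector_derivative (2 * of_real pi * \<i> * \<gamma> t) * (d (\<gamma> t) * q (\<gamma> t))) (at t within {0..1})"
        by (rule field_vector_diff_chain_within[OF d\<gamma>])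
           (use der[OF sph] has_field_derivative_at_within in blast)
      have 2: "((exp \<circ> (\<lambda>t. - L t)) has_vector_derivative (- w t) * exp (- L t)) (at t within {0..1})"
        by (rule field_vector_diff_chain_within[OF has_vector_derivative_minus[OF dL[OF t]]])
           (auto intro!: derivative_eq_intros)
      show ?thesis
        using has_vector_derivative_mult[OF 2 1]
        by (simp add: o_def w_def algebra_simps)
    qed
    then obtain C where C: "\<And>t. t \<in> {0..1} \<Longrightarrow> exp (- L t) * q (\<gamma> t) = C"
      using has_vector_derivative_zero_constant[of "{0..1}" "\<lambda>t. exp (- L t) * q (\<gamma> t)"]
      by auto
    have "exp (- L 0) * q (\<gamma> 0) = 1"
      using nz by (simp add: L_def exp_minus \<gamma>)
    then have "exp (- L t) * q (\<gamma> t) = 1" using C[of 0] C[OF t] by simp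
    then show ?thesis by (simp add: exp_minus field_simps)
  qed
  have "L 1 - L 0 = contour_integral \<gamma> d"
    unfolding contour_integral_integral L_def vector_derivative_at[OF d\<gamma>]
    by (simp add: w_def mult_ac)
  then have ends: "L 1 = L 0 + 2 * of_real pi * \<i> * of_int m"
    using int unfolding \<gamma>_def by (simp add: algebra_simps)
  show ?thesis
  proof (rule no_upward_crossing)
    show "((\<lambda>t. Im (L t)) has_real_derivative Im (w t)) (at t within {0..1})" if "t \<in> {0..1}" for t
      using bounded_linear.has_vector_derivative[OF bounded_linear_Im dL[OF that]]
      by (simp add: has_real_derivative_iff_has_vector_derivative)
    show "Im (L 1) = Im (L 0) + 2 * pi * of_int m"
      by (simp add: ends)
    show "Im (w t) < 0" if t: "t \<in> {0..1}" and B: "Im (L t) = pi + 2 * pi * of_int j" for t j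
    proof -
      have "q (\<gamma> t) = of_real (exp (Re (L t))) * cis (Im (L t))"
        using expL[OF t] by (metis exp_eq_polar exp_of_real)
      \<comment> \<open>At odd multiples of pi, \<open>q\<close> takes a negative real value, so the
        sign hypothesis applies.\<close>
      also have "cis (Im (L t)) = -1"
        unfolding B by (simp add: cis_mult[symmetric] cis_multiple_2pi)
      finally have "q (\<gamma> t) \<in> \<real>\<^sub>\<le>\<^sub>0"
        by (simp add: complex_nonpos_Reals_iff)
      from neg[OF sph this] show ?thesis
        by (simp add: w_def mult_pos_neg)
    qed
  qed
qed

subsection \<open>Counting zeros in discs\<close>

definition zero_count :: "(complex \<Rightarrow> complex) \<Rightarrow> real \<Rightarrow> int" where
  "zero_count F \<rho> = (\<Sum>w | w \<in> ball 0 \<rho> \<and> F w = 0. zorder F w)"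

lemma finite_zeros_cball:
  assumes "F holomorphic_on ball 0 1" "\<not> F constant_on ball 0 1" "R < 1"
  shows "finite {z \<in> cball 0 R. F z = 0}"
  by (rule holomorphic_compact_finite_zeros[OF assms(1) open_ball connected_ball compact_cball _ assms(2)])
     (use \<open>R < 1\<close> in auto)

text \<open>The argument principle and the theorem of Rouche yield sums weighted by winding numbers.
  For a circle the weight is 1 inside and 0 outside, so only the zeros in the small disc
  survive.\<close>

lemma winding_sum_eq_zero_count:
  assumes fin: "finite {w \<in> ball 0 R. F w = 0}" and "0 < \<rho>" "\<rho> < R"
    and nz: "\<And>z. z \<in> sphere 0 \<rho> \<Longrightarrow> F z \<noteq> 0"
  shows "(\<Sum>w | w \<in> ball 0 R \<and> F w = 0. winding_number (circlepath 0 \<rho>) w * of_int (zorder F w))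
           = of_int (zero_count F \<rho>)"
proof -
  have "(\<Sum>w | w \<in> ball 0 R \<and> F w = 0. winding_number (circlepath 0 \<rho>) w * of_int (zorder F w))
      = (\<Sum>w | w \<in> ball 0 \<rho> \<and> F w = 0. winding_number (circlepath 0 \<rho>) w * of_int (zorder F w))"
  proof (rule sum.mono_neutral_right[OF fin])
    show "\<forall>w\<in>{w \<in> ball 0 R. F w = 0} - {w \<in> ball 0 \<rho>. F w = 0}.
        winding_number (circlepath 0 \<rho>) w * of_int (zorder F w) = 0"
    proof
      fix w assume w: "w \<in> {w \<in> ball 0 R. F w = 0} - {w \<in> ball 0 \<rho>. F w = 0}"
      then have "w \<notin> cball 0 \<rho>" using nz[of w] by force
      then have "winding_number (circlepath 0 \<rho>) w = 0"
        using \<open>0 < \<rho>\<close> by (intro winding_number_zero_outside[of _ "cball 0 \<rho>"]) (auto simp: abs_of_pos)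
      then show "winding_number (circlepath 0 \<rho>) w * of_int (zorder F w) = 0" by simp
    qed
  qed (use \<open>\<rho> < R\<close> in auto)
  also have "\<dots> = (\<Sum>w | w \<in> ball 0 \<rho> \<and> F w = 0. of_int (zorder F w))"
    by (intro sum.cong) (auto simp: winding_number_circlepath)
  finally show ?thesis by (simp add: zero_count_def)
qed

text \<open>The argument principle, used in a disc of radius \<open>R\<close> between
  \<open>\<rho>\<close> and 1, where compactness of the closed disc makes the zeros finite in
  number.\<close>

lemma contour_integral_logderiv_circle:
  assumes hol: "F holomorphic_on ball 0 1" and nc: "\<not> F constant_on ball 0 1"
    and \<rho>: "0 < \<rho>" "\<rho> < 1" and nz: "\<And>z. z \<in> sphere 0 \<rho> \<Longrightarrow> F z \<noteq> 0"
  shows "contour_integral (circlepath 0 \<rho>) (\<lambda>z. deriv F z / F z) =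
           2 * of_real pi * \<i> * of_int (zero_count F \<rho>)"
proof -
  obtain R where R: "\<rho> < R" "R < 1" using \<rho> dense by blast
  have fin: "finite {w \<in> ball 0 R. F w = 0}"
    by (rule finite_subset[OF _ finite_zeros_cball[OF hol nc R(2)]]) auto
  have "contour_integral (circlepath 0 \<rho>) (\<lambda>z. deriv F z * 1 / F z) =
          2 * pi * \<i> * (\<Sum>w\<in>{w \<in> ball 0 R. F w = 0 \<or> w \<in> {}}. winding_number (circlepath 0 \<rho>) w * 1 * zorder F w)"
  proof (rule argument_principle)
    show "F holomorphic_on ball 0 R - {}"
      using hol by (rule holomorphic_on_subset) (use R in auto)
    show "path_image (circlepath 0 \<rho>) \<subseteq> ball 0 R - {w \<in> ball 0 R. F w = 0 \<or> w \<in> {}}"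
      using \<rho> R nz by auto
    show "\<forall>z. z \<notin> ball 0 R \<longrightarrow> winding_number (circlepath 0 \<rho>) z = 0"
      using \<rho> R by (auto intro!: winding_number_zero_outside[of _ "ball 0 R"])
  qed (use fin in auto)
  then show ?thesis
    using winding_sum_eq_zero_count[OF fin \<rho>(1) R(1) nz] by simp
qed

lemma zero_count_Rouche:
  assumes F: "F holomorphic_on ball 0 1" "\<not> F constant_on ball 0 1"
    and \<rho>: "0 < \<rho>" "\<rho> < 1" and a: "\<And>z. z \<in> sphere 0 \<rho> \<Longrightarrow> cmod a < cmod (F z)"
  shows "zero_count (\<lambda>z. F z - a) \<rho> = zero_count F \<rho>"
proof -
  have hol: "(\<lambda>z. F z + - a) holomorphic_on ball 0 1"
    by (intro holomorphic_intros F)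
  have nc: "\<not> (\<lambda>z. F z + - a) constant_on ball 0 1"
    using F(2) unfolding constant_on_def by (metis add_diff_cancel_right' diff_minus_eq_add)
  obtain R where R: "\<rho> < R" "R < 1" using \<rho> dense by blast
  have fin: "finite {w \<in> ball 0 R. F w = 0}"
    by (rule finite_subset[OF _ finite_zeros_cball[OF F R(2)]]) auto
  have fin': "finite {w \<in> ball 0 R. F w + - a = 0}"
    by (rule finite_subset[OF _ finite_zeros_cball[OF hol nc R(2)]]) auto
  have "(\<Sum>w | w \<in> ball 0 R \<and> F w + - a = 0. winding_number (circlepath 0 \<rho>) w * zorder (\<lambda>z. F z + - a) w)
      = (\<Sum>w | w \<in> ball 0 R \<and> F w = 0. winding_number (circlepath 0 \<rho>) w * zorder F w)"
  proof (rule Rouche_theorem[OF open_ball connected_ball fin' fin])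
    show "F holomorphic_on ball 0 R"
      using F(1) by (rule holomorphic_on_subset) (use R in auto)
    show "\<forall>z. z \<notin> ball 0 R \<longrightarrow> winding_number (circlepath 0 \<rho>) z = 0"
      using \<rho> R by (auto intro!: winding_number_zero_outside[of _ "ball 0 R"])
  qed (use \<rho> R a in auto)
  moreover have "F z \<noteq> 0" "F z + - a \<noteq> 0" if "z \<in> sphere 0 \<rho>" for z
    using a[OF that] norm_ge_zero[of a] by (auto simp: less_le_not_le)
  ultimately have "(of_int (zero_count (\<lambda>z. F z + - a) \<rho>) :: complex) = of_int (zero_count F \<rho>)"
    using winding_sum_eq_zero_count[OF fin \<rho>(1) R(1)] winding_sum_eq_zero_count[OF fin' \<rho>(1) R(1)] by simp
  then show ?thesis by simp
qed

text \<open>All orders of zeros are positive because \<open>F\<close> is not constant, so a zero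
  that lies only in the larger disc increases the count strictly.\<close>

lemma zero_count_insert:
  assumes F: "F holomorphic_on ball 0 1" "\<not> F constant_on ball 0 1"
    and "\<rho> \<le> \<rho>'" "\<rho>' < 1" and z: "\<rho> \<le> cmod z" "cmod z < \<rho>'" "F z = 0"
  shows "zero_count F \<rho> < zero_count F \<rho>'"
proof -
  have "\<exists>w\<in>ball 0 1. F w \<noteq> 0"
    using F(2) unfolding constant_on_def by blast
  then have pos: "zorder F w > 0" if "w \<in> ball 0 1" "F w = 0" for w
    using zorder_exist_zero[OF F(1) open_ball connected_ball that(1)] that(2) by simp
  have fin: "finite {w. w \<in> ball 0 \<rho>' \<and> F w = 0}"
    by (rule finite_subset[OF _ finite_zeros_cball[OF F assms(4)]]) auto
  show ?thesis
    unfolding zero_count_def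
  proof (rule sum_strict_mono2[OF fin])
    show "z \<in> {w. w \<in> ball 0 \<rho>' \<and> F w = 0} - {w. w \<in> ball 0 \<rho> \<and> F w = 0}" using z by auto
  qed (use assms pos[of z] in \<open>auto intro!: less_imp_le[OF pos]\<close>)
qed

subsection \<open>Valence of close-to-convex functions\<close>

text \<open>The normal form in which all estimates are made, free of \<open>k\<close>:
  \<open>z ^ p * exp (v z)\<close> is the starlike function G, \<open>h\<close> is z f' / G, and
  \<open>f1\<close> is f / z^p with the singularity at 0 removed. The exponential records that G has
  no zero besides the one at the origin.\<close>

locale close_to_convex =
  fixes p :: nat and \<gamma> :: real and f f1 v h :: "complex \<Rightarrow> complex"
  assumes p_pos: "p \<ge> 1" and \<gamma>: "0 \<le> \<gamma>" "\<gamma> < real p"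
    and f1_hol: "f1 holomorphic_on ball 0 1"
    and v_hol: "v holomorphic_on ball 0 1"
    and h_hol: "h holomorphic_on ball 0 1"
    and f_eq: "z \<in> ball 0 1 \<Longrightarrow> f z = z ^ p * f1 z"
    and f1_0: "f1 0 = 1" and v_0: "v 0 = 0" and h_0: "h 0 = of_nat p"
    and f_der: "z \<in> ball 0 1 \<Longrightarrow> (f has_field_derivative z ^ (p - 1) * exp (v z) * h z) (at z)"
    and starlike: "z \<in> ball 0 1 \<Longrightarrow> Re (of_nat p + z * deriv v z) > 0"
    and Re_h: "z \<in> ball 0 1 \<Longrightarrow> Re (h z) > \<gamma>"
begin

lemma f_hol: "f holomorphic_on ball 0 1"
  using f_der holomorphic_on_open by blast

lemma deriv_f: "z \<in> ball 0 1 \<Longrightarrow> deriv f z = z ^ (p - 1) * exp (v z) * h z"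
  using f_der DERIV_imp_deriv by blast

lemma h_nz: "z \<in> ball 0 1 \<Longrightarrow> h z \<noteq> 0"
  using Re_h[of z] \<gamma> by force

lemma deriv_f_nz: "z \<in> ball 0 1 \<Longrightarrow> z \<noteq> 0 \<Longrightarrow> deriv f z \<noteq> 0"
  using h_nz deriv_f by simp

lemma f_0: "f 0 = 0"
  using f_eq[of 0] p_pos by simp

lemma f_minus_hol: "(\<lambda>z. f z - a) holomorphic_on ball 0 1"
  by (intro holomorphic_intros f_hol)

lemma f_minus_nonconst: "\<not> (\<lambda>z. f z - a) constant_on ball 0 1"
proof
  assume "(\<lambda>z. f z - a) constant_on ball 0 1"
  then obtain c where c: "\<And>z. z \<in> ball 0 1 \<Longrightarrow> f z = c"
    unfolding constant_on_def by (metis diff_add_cancel)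
  have "deriv f (1/2) = deriv (\<lambda>_. c) (1/2)"
    by (intro deriv_cong_ev eventually_nhds_in_open[THEN eventually_mono, of "ball 0 1"])
       (auto simp: c)
  then show False using deriv_f_nz[of "1/2"] by simp
qed

lemma f_nonconst: "\<not> f constant_on ball 0 1"
  using f_minus_nonconst[of 0] by simp

lemma zorder_f_0: "zorder f 0 = int p"
  by (rule zorder_eqI[of "ball 0 1" _ f1]) (auto simp: f1_hol f1_0 f_eq mult.commute)

text \<open>The index of (f - a) / G along the circle is the number of zeros of f - a minus the
  \<open>p\<close> zeros of G, and \<open>circle_index_nonpos\<close> shows that it is at most
  0.\<close>

lemma zero_count_le:
  assumes \<rho>: "0 < \<rho>" "\<rho> < 1" and nz: "\<And>z. z \<in> sphere 0 \<rho> \<Longrightarrow> f z \<noteq> a"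
  shows "zero_count (\<lambda>z. f z - a) \<rho> \<le> int p"
proof -
  \<comment> \<open>The logarithmic derivative of \<open>q\<close>, split so that the terms
    integrate separately: the first counts zeros, the second gives \<open>p\<close> turns, and the
    third integrates to 0 by Cauchy's theorem.\<close>
  define d where "d = (\<lambda>z. deriv f z / (f z - a) - of_nat p * (1 / (z - 0)) - deriv v z)"
  define q where "q = (\<lambda>z. (f z - a) * exp (- v z) / z ^ p)"
  have sub: "sphere 0 \<rho> \<subseteq> ball 0 1" using \<rho> by auto
  have cont_f: "continuous_on (sphere 0 \<rho>) f" "continuous_on (sphere 0 \<rho>) (deriv f)"
      "continuous_on (sphere 0 \<rho>) (deriv v)"
    by (intro holomorphic_on_imp_continuous_on holomorphic_on_subset[OF _ sub] holomorphic_deriv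
        f_hol v_hol open_ball)+
  have cont1: "continuous_on (sphere 0 \<rho>) (\<lambda>z. deriv f z / (f z - a))"
    using nz by (intro continuous_intros cont_f) auto
  have cont2: "continuous_on (sphere 0 \<rho>) (\<lambda>z. of_nat p * (1 / (z - 0)) :: complex)"
    using \<rho> by (intro continuous_intros) auto
  have img: "path_image (circlepath 0 \<rho>) \<subseteq> sphere 0 \<rho>" using \<rho> by simp
  have i1: "(\<lambda>z. deriv f z / (f z - a)) contour_integrable_on circlepath 0 \<rho>"
    and i2: "(\<lambda>z. of_nat p * (1 / (z - 0))) contour_integrable_on circlepath 0 \<rho>"
    using \<rho> cont1 cont2 by (auto intro!: contour_integrable_continuous_circlepath)
  have i2': "(\<lambda>z::complex. 1 / (z - 0)) contour_integrable_on circlepath 0 \<rho>"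
    using \<rho> by (intro contour_integrable_continuous_circlepath continuous_intros) auto
  have i3: "(deriv v has_contour_integral 0) (circlepath 0 \<rho>)"
    using \<rho> by (intro Cauchy_theorem_convex_simple[of _ "ball 0 1"] holomorphic_deriv v_hol) auto
  have c1: "contour_integral (circlepath 0 \<rho>) (\<lambda>z. deriv f z / (f z - a)) =
      2 * of_real pi * \<i> * of_int (zero_count (\<lambda>z. f z - a) \<rho>)"
  proof -
    have "contour_integral (circlepath 0 \<rho>) (\<lambda>z. deriv f z / (f z - a)) =
        contour_integral (circlepath 0 \<rho>) (\<lambda>z. deriv (\<lambda>x. f x - a) z / (f z - a))"
    proof (rule contour_integral_cong)
      fix z :: complex assume "z \<in> path_image (circlepath 0 \<rho>)"
      then have "z \<in> ball 0 1" using img sub by blast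
      then have "((\<lambda>z. f z - a) has_field_derivative deriv f z - 0) (at z)"
        by (intro DERIV_diff DERIV_const holomorphic_derivI[OF f_hol open_ball])
      then have "deriv (\<lambda>z. f z - a) z = deriv f z"
        by (simp add: DERIV_imp_deriv)
      then show "deriv f z / (f z - a) = deriv (\<lambda>z. f z - a) z / (f z - a)" by simp
    qed simp
    also have "\<dots> = 2 * of_real pi * \<i> * of_int (zero_count (\<lambda>z. f z - a) \<rho>)"
      using nz by (intro contour_integral_logderiv_circle f_minus_hol f_minus_nonconst \<rho>) auto
    finally show ?thesis .
  qed
  have c2: "contour_integral (circlepath 0 \<rho>) (\<lambda>z. of_nat p * (1 / (z - 0))) = of_nat p * (2 * of_real pi * \<i>)"
    using contour_integral_lmul[OF i2', of "of_nat p"] contour_integral_circlepath[of \<rho> 0] \<rho> by simp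
  have int: "contour_integral (circlepath 0 \<rho>) d =
      2 * of_real pi * \<i> * of_int (zero_count (\<lambda>z. f z - a) \<rho> - int p)"
    unfolding d_def
    using contour_integral_diff[OF contour_integrable_diff[OF i1 i2] has_contour_integral_integrable[OF i3]]
      contour_integral_diff[OF i1 i2] contour_integral_unique[OF i3] c1 c2
    by (simp add: algebra_simps)
  have "zero_count (\<lambda>z. f z - a) \<rho> - int p \<le> 0"
  proof (rule circle_index_nonpos[OF \<rho>(1) _ _ _ _ int])
    show "continuous_on (sphere 0 \<rho>) d"
      unfolding d_def by (intro continuous_on_diff cont1 cont2 cont_f)
    show "q (of_real \<rho>) \<noteq> 0"
      using \<rho> nz[of "of_real \<rho>"] unfolding q_def by auto
  next
    fix z :: complex assume z: "z \<in> sphere 0 \<rho>"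
    have zb: "z \<in> ball 0 1" and z0: "z \<noteq> 0" and fz: "f z \<noteq> a"
      using z sub \<rho> nz by auto
    have zp: "z ^ p = z * z ^ (p - 1)" using p_pos by (cases p) auto
    show "(q has_field_derivative d z * q z) (at z)"
      unfolding q_def d_def
      by (rule derivative_eq_intros holomorphic_derivI[OF f_hol open_ball zb] 
          holomorphic_derivI[OF v_hol open_ball zb] refl)+
         (use z0 fz in \<open>simp_all add: divide_simps zp algebra_simps power2_eq_square\<close>)
    assume qn: "q z \<in> \<real>\<^sub>\<le>\<^sub>0"
    have "q z \<noteq> 0" unfolding q_def using z0 fz by simp
    with qn obtain t where t: "q z = of_real t" "t < 0"
      by (metis nonpos_Reals_cases of_real_0 less_eq_real_def)
    have "z * d z = h z / q z - (of_nat p + z * deriv v z)"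
      unfolding q_def d_def deriv_f[OF zb] using z0 fz
      by (simp add: divide_simps zp exp_minus algebra_simps)
    then have "Re (z * d z) = Re (h z) / t - Re (of_nat p + z * deriv v z)"
      by (simp add: t)
    moreover have "Re (h z) / t < 0"
      using Re_h[OF zb] \<gamma> t(2) by (simp add: divide_pos_neg)
    ultimately show "Re (z * d z) < 0" using starlike[OF zb] by linarith
  qed
  then show ?thesis by simp
qed

text \<open>The \<open>a\<close>-points in a closed disc are finite in number, so their moduli
  cannot fill an interval of radii. This supplies circles to which \<open>zero_count_le\<close>
  applies.\<close>

lemma exists_clean_radius:
  assumes "0 \<le> s" "s < 1"
  obtains \<rho> where "s < \<rho>" "\<rho> < 1" "\<And>z. z \<in> sphere 0 \<rho> \<Longrightarrow> f z \<noteq> a"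
proof -
  obtain R where R: "s < R" "R < 1" using assms dense by blast
  have "finite (cmod ` {z \<in> cball 0 R. f z - a = 0})"
    by (intro finite_imageI finite_zeros_cball f_minus_hol f_minus_nonconst R)
  moreover have "infinite {s<..<R}" using R by (simp add: infinite_Ioo)
  ultimately obtain \<rho> where "\<rho> \<in> {s<..<R}" "\<rho> \<notin> cmod ` {z \<in> cball 0 R. f z - a = 0}"
    by (meson finite_subset subsetI)
  then show ?thesis using R that[of \<rho>] by force
qed

text \<open>The zero at the origin already has order \<open>p\<close>; a further zero would push the
  count on a larger circle above the bound of \<open>zero_count_le\<close>.\<close>

lemma f_nz:
  assumes "z \<noteq> 0" "cmod z < 1"
  shows "f z \<noteq> 0"
proof
  assume fz: "f z = 0"
  have "isCont f1 0"
    using f1_hol holomorphic_on_imp_continuous_on continuous_on_eq_continuous_at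
    by (metis centre_in_ball open_ball zero_less_one)
  then obtain e where e: "e > 0" "\<And>w. cmod w < e \<Longrightarrow> f1 w \<noteq> 0"
    using continuous_at_avoid[of 0 f1 0] f1_0 by (auto simp: dist_norm)
  \<comment> \<open>Small enough that \<open>f1\<close> has no zero in the disc and that
    \<open>z\<close> lies outside it.\<close>
  define \<epsilon> where "\<epsilon> = min e (cmod z)"
  have \<epsilon>: "\<epsilon> > 0" "\<epsilon> \<le> cmod z" "\<And>w. cmod w < \<epsilon> \<Longrightarrow> f1 w \<noteq> 0"
    using e assms unfolding \<epsilon>_def by auto
  have "{w. w \<in> ball 0 \<epsilon> \<and> f w = 0} = {0}"
    using \<epsilon> assms f_0 by (auto simp: f_eq)
  then have "zero_count f \<epsilon> = int p"
    by (simp add: zero_count_def zorder_f_0)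
  moreover obtain \<rho> where \<rho>: "cmod z < \<rho>" "\<rho> < 1" "\<And>z. z \<in> sphere 0 \<rho> \<Longrightarrow> f z \<noteq> 0"
    using exists_clean_radius[of "cmod z" 0] assms by auto
  moreover have "zero_count f \<epsilon> < zero_count f \<rho>"
    by (rule zero_count_insert[OF f_hol f_nonconst]) (use \<epsilon> \<rho> fz in auto)
  ultimately show False
    using zero_count_le[of \<rho> 0] le_less_trans[OF norm_ge_zero \<rho>(1)] by simp
qed

lemma zero_count_f:
  assumes "0 < r" "r < 1"
  shows "zero_count f r = int p"
proof -
  have "{w. w \<in> ball 0 r \<and> f w = 0} = {0}"
    using assms f_0 f_nz by force
  then show ?thesis by (simp add: zero_count_def zorder_f_0)
qed

text \<open>A value smaller than the minimum of \<open>|f|\<close> on a circle is already taken \<open>p\<close> times inside it,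
  so by \<open>p\<close>-valence it is not taken outside.\<close>

lemma small_value_not_outside:
  assumes r: "0 < r" and a: "\<And>w. w \<in> sphere 0 r \<Longrightarrow> cmod a < cmod (f w)"
    and z: "r \<le> cmod z" "cmod z < 1"
  shows "f z \<noteq> a"
proof
  assume fz: "f z = a"
  obtain \<rho> where \<rho>: "cmod z < \<rho>" "\<rho> < 1" "\<And>z. z \<in> sphere 0 \<rho> \<Longrightarrow> f z \<noteq> a"
    using exists_clean_radius[of "cmod z" a] z r by auto
  have "zero_count (\<lambda>z. f z - a) r = int p"
    using zero_count_Rouche[OF f_hol f_nonconst r _ a] zero_count_f[OF r] z by auto
  moreover have "zero_count (\<lambda>z. f z - a) r < zero_count (\<lambda>z. f z - a) \<rho>"
    by (rule zero_count_insert[OF f_minus_hol f_minus_nonconst]) (use z \<rho> fz in auto)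
  moreover have "zero_count (\<lambda>z. f z - a) \<rho> \<le> int p"
    by (rule zero_count_le) (use \<rho> z r in auto)
  ultimately show False by linarith
qed

section \<open>Variation of the modulus of f along rays and circles\<close>

text \<open>One formula for two motions: \<open>c = 1\<close> moves along the ray through
  \<open>z\<close>, \<open>c = \<i>\<close> along its circle. It is the derivative of log |f|
  multiplied by |f|.\<close>

lemma cmod_f_spiral_deriv:
  assumes "z \<noteq> 0" "cmod z < 1"
  shows "((\<lambda>s. cmod (f (z * exp (of_real s * c)))) has_real_derivative
           cmod (f z) * Re (c * (z * deriv f z / f z))) (at 0)"
proof -
  have "((\<lambda>s. z * exp (of_real s * c)) has_vector_derivative z * c) (at 0)"
    by (rule has_vector_derivative_eq_rhs[OF has_vector_derivative_real_field[where f = "\<lambda>s. z * exp (s * c)" and f' = "z * c"]])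
       (auto intro!: derivative_eq_intros)
  moreover have "(f has_field_derivative deriv f z) (at (z * exp (of_real 0 * c)))"
    using holomorphic_derivI[OF f_hol open_ball, of z] assms by simp
  ultimately have "((f \<circ> (\<lambda>s. z * exp (of_real s * c))) has_vector_derivative (z * c) * deriv f z) (at 0)"
    by (rule field_vector_diff_chain_at)
  then have D: "((\<lambda>s. f (z * exp (of_real s * c))) has_derivative (\<lambda>t. t *\<^sub>R (z * c * deriv f z))) (at 0)"
    by (simp add: has_vector_derivative_def o_def)
  have "f z \<noteq> 0" using f_nz assms by blast
  then have N: "((\<lambda>s. norm (f (z * exp (of_real s * c)))) has_derivative
      (\<lambda>t. (t *\<^sub>R (z * c * deriv f z)) \<bullet> sgn (f z))) (at 0)"
    using has_derivative_compose[OF D has_derivative_norm[of "f (z * exp (of_real 0 * c))"]] by simp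
  \<comment> \<open>The derivative of the norm is the inner product with \<open>sgn (f z)\<close>;
    for complex numbers this is the real part of a quotient, up to the factor |f|.\<close>
  have I: "(z * c * deriv f z) \<bullet> sgn (f z) = cmod (f z) * Re (c * (z * deriv f z / f z))"
  proof -
    have "x \<bullet> sgn F = cmod F * Re (x / F)" if "F \<noteq> 0" for x F :: complex
    proof -
      have "x / F = x * cnj F / of_real ((cmod F)\<^sup>2)"
        using complex_div_cnj[of x F] by simp
      then have "Re (x / F) = Re (x * cnj F) / (cmod F)\<^sup>2"
        by (simp only: Re_divide_of_real)
      then show ?thesis
        using that by (simp add: sgn_div_norm inner_complex_def field_simps power2_eq_square)
    qed
    from this[OF \<open>f z \<noteq> 0\<close>, of "z * c * deriv f z"] show ?thesis
      by (simp add: mult_ac)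
  qed
  have "(\<lambda>t. (t *\<^sub>R (z * c * deriv f z)) \<bullet> sgn (f z)) =
      (*) (cmod (f z) * Re (c * (z * deriv f z / f z)))"
    unfolding inner_scaleR_left I by (rule ext) (rule mult.commute)
  with N show ?thesis
    unfolding has_field_derivative_def by (rule has_derivative_eq_rhs)
qed

text \<open>Minimality under rotation makes z f' / f real, and it is nonzero because f' is. Were it
  negative, |f| would decrease outwards and a value below the minimum would occur outside the
  circle, contrary to \<open>small_value_not_outside\<close>. A positive real number equals its
  modulus.\<close>

lemma logderiv_at_circle_min:
  assumes z: "z \<noteq> 0" "cmod z < 1" and min: "\<And>w. cmod w = cmod z \<Longrightarrow> cmod (f z) \<le> cmod (f w)"
  shows "cmod (f z) * Re (z * deriv f z / f z) = cmod z * cmod (deriv f z)"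
proof -
  define W where "W = z * deriv f z / f z"
  have fz: "f z \<noteq> 0" using f_nz z by blast
  have "cmod (f z) * Re (\<i> * W) = 0"
    by (rule DERIV_local_min[OF cmod_f_spiral_deriv[OF z, of \<i>, folded W_def], of 1])
       (auto intro!: min simp: norm_mult)
  then have "Im W = 0" using fz by simp
  have "W \<noteq> 0" unfolding W_def using z fz deriv_f_nz by auto
  have "\<not> Re W < 0"
  proof
    assume "Re W < 0"
    then have "cmod (f z) * Re (1 * W) < 0" using fz by (simp add: mult_pos_neg)
    from DERIV_neg_dec_right[OF cmod_f_spiral_deriv[OF z, of 1, folded W_def] this]
    obtain d where d: "d > 0" "\<And>s. 0 < s \<Longrightarrow> s < d \<Longrightarrow> cmod (f (z * exp (of_real s))) < cmod (f z)"
      by auto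
    \<comment> \<open>The second bound keeps the displaced point inside the unit disc, since its
      modulus is \<open>exp (ln (cmod z) + s)\<close>.\<close>
    define s where "s = min (d / 2) (- ln (cmod z) / 2)"
    have "- ln (cmod z) > 0" using z by simp
    then have s: "0 < s" "s < d" "s < - ln (cmod z)" using d(1) unfolding s_def by auto
    define w where "w = z * exp (of_real s)"
    have "cmod w = exp (ln (cmod z) + s)" using z by (simp add: w_def norm_mult exp_add)
    also have "\<dots> < 1" using s by simp
    finally have "cmod w < 1" .
    moreover have "cmod z \<le> cmod w" using s z by (simp add: w_def norm_mult)
    moreover have "cmod (f w) < cmod (f u)" if "u \<in> sphere 0 (cmod z)" for u
      using min[of u] d(2)[OF s(1,2)] that by (simp add: w_def)
    ultimately show False
      using small_value_not_outside[of "cmod z" "f w" w] z by auto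
  qed
  with \<open>Im W = 0\<close> have "Re W = cmod W"
    by (simp add: cmod_def)
  then show ?thesis using fz by (simp add: W_def norm_mult norm_divide)
qed

text \<open>The comparison is run at a minimum of \<open>|f w| - c \<Phi>(|w|)\<close> with \<open>c < 1\<close>; such a point also
  minimises \<open>|f|\<close> on its own circle.\<close>

lemma cmod_f_ge:
  fixes \<Phi> L :: "real \<Rightarrow> real"
  assumes z: "cmod z < 1" and "\<Phi> 0 = 0"
    and cont: "continuous_on {0..cmod z} \<Phi>"
    and der: "\<And>r. 0 < r \<Longrightarrow> r < 1 \<Longrightarrow> (\<Phi> has_real_derivative L r) (at r)"
    and pos: "\<And>r. 0 < r \<Longrightarrow> r < 1 \<Longrightarrow> L r > 0"
    and bnd: "\<And>w. 0 < cmod w \<Longrightarrow> cmod w < 1 \<Longrightarrow> L (cmod w) \<le> cmod (deriv f w)"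
  shows "\<Phi> (cmod z) \<le> cmod (f z)"
proof (rule ccontr)
  assume "\<not> \<Phi> (cmod z) \<le> cmod (f z)"
  then have less: "cmod (f z) < \<Phi> (cmod z)" by simp
  then have \<Phi>pos: "\<Phi> (cmod z) > 0" by (metis norm_ge_zero order_le_less_trans)
  then have "cmod (f z) / \<Phi> (cmod z) < 1" using less by simp
  then obtain c where "cmod (f z) / \<Phi> (cmod z) < c" "c < 1" using dense by blast
  with \<Phi>pos have c: "cmod (f z) < c * \<Phi> (cmod z)" "c < 1" by (simp_all add: field_simps)
  define \<psi> where "\<psi> = (\<lambda>w. cmod (f w) - c * \<Phi> (cmod w))"
  have "continuous_on (cball 0 (cmod z)) f"
    using f_hol by (intro holomorphic_on_imp_continuous_on) (use z in \<open>auto elim!: holomorphic_on_subset\<close>)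
  moreover have "continuous_on (cball 0 (cmod z)) (\<lambda>w::complex. \<Phi> (cmod w))"
    by (rule continuous_on_compose2[OF cont]) (auto intro!: continuous_intros)
  ultimately have "continuous_on (cball 0 (cmod z)) \<psi>"
    unfolding \<psi>_def by (intro continuous_intros)
  then obtain w where w: "w \<in> cball 0 (cmod z)" "\<And>u. u \<in> cball 0 (cmod z) \<Longrightarrow> \<psi> w \<le> \<psi> u"
    using continuous_attains_inf[of "cball 0 (cmod z)" \<psi>] by auto
  have "\<psi> w < 0" using w(2)[of z] c by (auto simp: \<psi>_def)
  \<comment> \<open>At the origin \<open>\<psi>\<close> is 0, so a negative minimum lies
    elsewhere.\<close>
  then have w0: "w \<noteq> 0" using f_0 \<open>\<Phi> 0 = 0\<close> by (auto simp: \<psi>_def)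
  have w1: "cmod w < 1" using w z by auto
  have "cmod (f w) \<le> cmod (f u)" if "cmod u = cmod w" for u
    using w(2)[of u] w(1) that by (auto simp: \<psi>_def)
  note rad = logderiv_at_circle_min[OF w0 w1 this]
  have "((\<lambda>s. \<Phi> (cmod w * exp s)) has_real_derivative L (cmod w) * (cmod w * 1)) (at 0)"
  proof (rule DERIV_chain2[where f = \<Phi>])
    show "(\<Phi> has_real_derivative L (cmod w)) (at (cmod w * exp 0))" using der w0 w1 by simp
  qed (auto intro!: derivative_eq_intros)
  then have "((\<lambda>s. \<psi> (w * exp (of_real s * 1))) has_real_derivative
      cmod (f w) * Re (1 * (w * deriv f w / f w)) - c * (L (cmod w) * (cmod w * 1))) (at 0)"
    unfolding \<psi>_def using cmod_f_spiral_deriv[OF w0 w1, of 1]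
    by (auto intro!: derivative_eq_intros simp: norm_mult)
  \<comment> \<open>By \<open>rad\<close> the expression is |w| (|f'(w)| - c L(|w|)); the slack
    \<open>c < 1\<close> makes it strictly positive. Moving inwards then lowers
    \<open>\<psi>\<close> without leaving the disc, against minimality.\<close>
  moreover have "cmod (f w) * Re (1 * (w * deriv f w / f w)) - c * (L (cmod w) * (cmod w * 1)) > 0"
  proof -
    have "c * L (cmod w) < 1 * L (cmod w)"
      using pos[of "cmod w"] w0 w1 c by (intro mult_strict_right_mono) auto
    also have "\<dots> \<le> cmod (deriv f w)" using bnd[of w] w0 w1 by simp
    finally have "cmod w * (c * L (cmod w)) < cmod w * cmod (deriv f w)"
      using w0 by (intro mult_strict_left_mono) auto
    with rad show ?thesis by (simp add: mult_ac)
  qed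
  ultimately obtain d where d: "d > 0" "\<And>s. 0 < s \<Longrightarrow> s < d \<Longrightarrow> \<psi> (w * exp (of_real (0 - s) * 1)) < \<psi> (w * exp (of_real 0 * 1))"
    using DERIV_pos_inc_left by blast
  define s where "s = d / 2"
  have s: "0 < s" "s < d" using d(1) unfolding s_def by auto
  have "cmod (w * exp (of_real (0 - s) * 1)) \<le> cmod w * 1"
    unfolding norm_mult using s by (intro mult_left_mono) auto
  then have "w * exp (of_real (0 - s) * 1) \<in> cball 0 (cmod z)" using w(1) by auto
  from w(2)[OF this] d(2)[OF s] show False by simp
qed

end

subsection \<open>Growth estimates\<close>

text \<open>The Moebius map (w - c) / (w + c) sends the right half-plane to the unit disc and
  \<open>c\<close> to 0. Schwarz's lemma for its composition with \<open>H\<close> gives |H - c| <=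
  |z| |H + c|, from which both bounds follow.\<close>

lemma Caratheodory_bounds:
  assumes hol: "H holomorphic_on ball 0 1" and pos: "\<And>z. z \<in> ball 0 1 \<Longrightarrow> Re (H z) > 0"
    and H0: "H 0 = of_real c" and z: "cmod z < 1"
  shows "cmod (H z) \<le> c * (1 + cmod z) / (1 - cmod z)"
    and "c * (1 - cmod z) / (1 + cmod z) \<le> Re (H z)"
proof -
  have c: "c > 0" using pos[of 0] H0 by simp
  define \<phi> where "\<phi> = (\<lambda>w. (H w - of_real c) / (H w + of_real c))"
  have nz: "H w + of_real c \<noteq> 0" if "w \<in> ball 0 1" for w
    using pos[OF that] c by (auto simp: complex_eq_iff)
  have "cmod (\<phi> w) < 1" if "cmod w < 1" for w
  proof -
    have "(cmod (H w - of_real c))\<^sup>2 < (cmod (H w + of_real c))\<^sup>2"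
      using mult_pos_pos[OF c pos[of w]] that unfolding cmod_power2
      by (simp add: power2_eq_square algebra_simps)
    then have "cmod (H w - of_real c) < cmod (H w + of_real c)"
      by (rule power2_less_imp_less) simp
    then show ?thesis using nz[of w] that by (simp add: \<phi>_def norm_divide)
  qed
  moreover have "\<phi> holomorphic_on ball 0 1"
    unfolding \<phi>_def using nz by (intro holomorphic_intros hol) auto
  ultimately have "cmod (\<phi> z) \<le> cmod z"
    using Schwarz_Lemma(1)[of \<phi> z] z by (simp add: \<phi>_def H0)
  then have le: "cmod (H z - of_real c) \<le> cmod z * cmod (H z + of_real c)"
    using nz[of z] z by (simp add: \<phi>_def norm_divide divide_le_eq)
  have "cmod (H z) - c \<le> cmod (H z - of_real c)"
    using norm_triangle_ineq2[of "H z" "of_real c"] c by simp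
  also note le
  also have "cmod z * cmod (H z + of_real c) \<le> cmod z * (cmod (H z) + c)"
    using norm_triangle_ineq[of "H z" "of_real c"] c by (intro mult_left_mono) auto
  finally show "cmod (H z) \<le> c * (1 + cmod z) / (1 - cmod z)"
    using z by (simp add: field_simps)
  define r x where "r = cmod z" and "x = Re (H z)"
  have r: "0 \<le> r" "r < 1" using z by (auto simp: r_def)
  have "(cmod (H z - of_real c))\<^sup>2 \<le> (r * cmod (H z + of_real c))\<^sup>2"
    using le by (intro power_mono) (auto simp: r_def)
  then have "(x - c)\<^sup>2 + (Im (H z))\<^sup>2 \<le> r\<^sup>2 * ((x + c)\<^sup>2 + (Im (H z))\<^sup>2)"
    by (simp add: cmod_power2 power_mult_distrib x_def)
  moreover have "r\<^sup>2 * (Im (H z))\<^sup>2 \<le> 1 * (Im (H z))\<^sup>2"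
    using r by (intro mult_right_mono) (auto simp: power_le_one)
  ultimately have "(x - c)\<^sup>2 \<le> r\<^sup>2 * (x + c)\<^sup>2"
    by (simp add: algebra_simps)
  then have "\<bar>x - c\<bar> \<le> r * (x + c)"
    using r pos[of z] c z abs_le_square_iff[of "x - c" "r * (x + c)"]
    by (simp add: power_mult_distrib x_def)
  then show "c * (1 - cmod z) / (1 + cmod z) \<le> Re (H z)"
    using r unfolding r_def[symmetric] x_def[symmetric] by (simp add: field_simps)
qed

lemma has_real_derivative_integral_upper:
  fixes u :: "real \<Rightarrow> real"
  assumes "continuous_on {0..b} u" "0 < r" "r < b"
  shows "((\<lambda>t. integral {0..t} u) has_real_derivative u r) (at r)"
proof -
  have "((\<lambda>t. integral {0..t} u) has_vector_derivative u r) (at r within {0..b})"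
    using assms by (intro integral_has_vector_derivative) auto
  then show ?thesis
    using assms by (simp add: has_real_derivative_iff_has_vector_derivative at_within_Icc_at)
qed

context close_to_convex
begin

lemma v_has_deriv: "z \<in> ball 0 1 \<Longrightarrow> (v has_field_derivative deriv v z) (at z)"
  using holomorphic_derivI[OF v_hol open_ball] .

lemma v_radial_deriv:
  assumes "cmod z < 1" "0 < t" "t < 1"
  shows "((\<lambda>t. Re (v (of_real t * z))) has_real_derivative Re (z * deriv v (of_real t * z))) (at t)"
proof -
  have tz: "of_real t * z \<in> ball 0 1"
    using assms mult_strict_mono[of t 1 "cmod z" 1] by (simp add: norm_mult)
  have "((\<lambda>s. of_real s * z) has_vector_derivative z) (at t)"
    by (rule has_vector_derivative_eq_rhs[OF has_vector_derivative_real_field[where f = "\<lambda>s. s * z" and f' = z]])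
       (auto intro!: derivative_eq_intros)
  from bounded_linear.has_vector_derivative[OF bounded_linear_Re field_vector_diff_chain_at[OF this v_has_deriv[OF tz]]]
  show ?thesis
    by (simp only: o_def has_real_derivative_iff_has_vector_derivative)
qed

lemma v_radial_cont:
  assumes "cmod z < 1"
  shows "continuous_on {0..1} (\<lambda>t. Re (v (of_real t * z)))"
proof -
  have "continuous_on (ball 0 1) v" using v_hol holomorphic_on_imp_continuous_on by blast
  moreover have "continuous_on {0..1} (\<lambda>t. of_real t * z)"
    by (intro continuous_intros)
  moreover have "(\<lambda>t. of_real t * z) ` {0..1} \<subseteq> ball 0 1"
    using assms mult_left_le_one_le[of "cmod z"] by (fastforce simp: norm_mult)
  ultimately have "continuous_on {0..1} (\<lambda>t. v (of_real t * z))"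
    by (rule continuous_on_compose2)
  then show ?thesis by (rule continuous_on_Re)
qed

text \<open>\<open>Caratheodory_bounds\<close> for p + z v' confines the derivative of Re v(tz) in
  \<open>t\<close> between -2pr / (1 + tr) and 2pr / (1 - tr). These are the derivatives of -2p ln(1
  + tr) and -2p ln(1 - tr), so comparison on [0,1] gives the claim.\<close>

lemma starlike_factor_bounds:
  assumes z: "cmod z < 1"
  shows "Re (v z) \<le> - (2 * real p * ln (1 - cmod z))"
    and "- (2 * real p * ln (1 + cmod z)) \<le> Re (v z)"
proof -
  define r where "r = cmod z"
  have r: "0 \<le> r" "r < 1" using z by (auto simp: r_def)
  have hol: "(\<lambda>z. of_nat p + z * deriv v z) holomorphic_on ball 0 1"
    by (intro holomorphic_intros holomorphic_deriv v_hol open_ball)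
  note bnds = Caratheodory_bounds[OF hol starlike, of "real p", simplified]
  have dv: "Re (z * deriv v (of_real t * z)) \<le> 2 * real p * r / (1 - t * r)"
           "- (2 * real p * r / (1 + t * r)) \<le> Re (z * deriv v (of_real t * z))"
      and tr: "0 \<le> t * r" "t * r < 1" if t: "0 < t" "t < 1" for t
  proof -
    show tr: "0 \<le> t * r" "t * r < 1"
      using t r mult_strict_mono[of t 1 r 1] by auto
    define D where "D = Re (z * deriv v (of_real t * z))"
    have n: "cmod (of_real t * z) = t * r" using t by (simp add: norm_mult r_def)
    have P: "Re (of_nat p + of_real t * z * deriv v (of_real t * z)) = real p + t * D"
      by (simp add: D_def algebra_simps)
    \<comment> \<open>The estimate at the point tz concerns p + tD; subtracting \<open>p\<close>
      leaves a factor \<open>t\<close> on both sides, which cancels.\<close>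
    have "real p + t * D \<le> real p * (1 + t * r) / (1 - t * r)"
      using bnds(1)[of "of_real t * z"] complex_Re_le_cmod[of "of_nat p + of_real t * z * deriv v (of_real t * z)"]
        tr P by (simp add: n)
    then have "t * D \<le> t * (2 * real p * r / (1 - t * r))"
      using tr by (simp add: field_simps)
    then show "Re (z * deriv v (of_real t * z)) \<le> 2 * real p * r / (1 - t * r)"
      using t by (simp only: D_def mult_le_cancel_left_pos)
    have "real p * (1 - t * r) / (1 + t * r) \<le> real p + t * D"
      using bnds(2)[of "of_real t * z"] tr P by (simp add: n)
    then have "t * - (2 * real p * r / (1 + t * r)) \<le> t * D"
      using tr by (simp add: field_simps)
    then show "- (2 * real p * r / (1 + t * r)) \<le> Re (z * deriv v (of_real t * z))"
      using t by (simp only: D_def mult_le_cancel_left_pos)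
  qed
  have tr1: "t * r < 1" if "t \<in> {0..1}" for t
    using that r mult_left_le_one_le[of r t] by auto
  have "- Re (v (of_real 0 * z)) - 2 * real p * ln (1 - 0 * r)
        \<le> - Re (v (of_real 1 * z)) - 2 * real p * ln (1 - 1 * r)"
  proof (rule DERIV_nonneg_imp_increasing_open[of 0 1 "\<lambda>t. - Re (v (of_real t * z)) - 2 * real p * ln (1 - t * r)"])
    fix t :: real assume t: "0 < t" "t < 1"
    have "((\<lambda>t. - Re (v (of_real t * z)) - 2 * real p * ln (1 - t * r)) has_real_derivative
        - Re (z * deriv v (of_real t * z)) + 2 * real p * r / (1 - t * r)) (at t)"
      by (rule derivative_eq_intros v_radial_deriv z t refl | use tr[OF t] in simp)+
    then show "\<exists>y. ((\<lambda>t. - Re (v (of_real t * z)) - 2 * real p * ln (1 - t * r)) has_real_derivative y) (at t) \<and> 0 \<le> y"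
      using dv(1)[OF t] by fastforce
  next
    have "1 - t * r \<noteq> 0" if "t \<in> {0..1}" for t
      using tr1[OF that] by simp
    then have "continuous_on {0..1} (\<lambda>t. ln (1 - t * r))"
      by (intro continuous_on_ln continuous_intros) auto
    then show "continuous_on {0..1} (\<lambda>t. - Re (v (of_real t * z)) - 2 * real p * ln (1 - t * r))"
      by (intro continuous_on_diff continuous_on_minus v_radial_cont z continuous_on_mult_left)
  qed simp
  then show "Re (v z) \<le> - (2 * real p * ln (1 - cmod z))"
    by (simp add: v_0 r_def)
  have "Re (v (of_real 0 * z)) + 2 * real p * ln (1 + 0 * r)
        \<le> Re (v (of_real 1 * z)) + 2 * real p * ln (1 + 1 * r)"
  proof (rule DERIV_nonneg_imp_increasing_open[of 0 1 "\<lambda>t. Re (v (of_real t * z)) + 2 * real p * ln (1 + t * r)"])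
    fix t :: real assume t: "0 < t" "t < 1"
    have "((\<lambda>t. Re (v (of_real t * z)) + 2 * real p * ln (1 + t * r)) has_real_derivative
        Re (z * deriv v (of_real t * z)) + 2 * real p * r / (1 + t * r)) (at t)"
      by (rule derivative_eq_intros v_radial_deriv z t refl | use tr[OF t] in simp)+
    then show "\<exists>y. ((\<lambda>t. Re (v (of_real t * z)) + 2 * real p * ln (1 + t * r)) has_real_derivative y) (at t) \<and> 0 \<le> y"
      using dv(2)[OF t] by fastforce
  next
    have "1 + t * r \<noteq> 0" if "t \<in> {0..1}" for t
      using add_pos_nonneg[of 1 "t * r"] that r by (metis atLeastAtMost_iff less_irrefl mult_nonneg_nonneg zero_less_one)
    then have "continuous_on {0..1} (\<lambda>t. ln (1 + t * r))"
      by (intro continuous_on_ln continuous_intros) auto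
    then show "continuous_on {0..1} (\<lambda>t. Re (v (of_real t * z)) + 2 * real p * ln (1 + t * r))"
      by (intro continuous_on_add v_radial_cont z continuous_on_mult_left)
  qed simp
  then show "- (2 * real p * ln (1 + cmod z)) \<le> Re (v z)"
    by (simp add: v_0 r_def)
qed

lemma exp_v_bounds:
  assumes z: "cmod z < 1"
  shows "cmod (exp (v z)) \<le> 1 / (1 - cmod z) ^ (2 * p)"
    and "1 / (1 + cmod z) ^ (2 * p) \<le> cmod (exp (v z))"
proof -
  have E: "exp (- (2 * real p * ln x)) = 1 / x ^ (2 * p)" if "x > 0" for x :: real
    using that exp_of_nat_mult[of "2 * p" "ln x"] by (simp add: exp_minus divide_inverse)
  have "0 < 1 + cmod z"
    using norm_ge_zero[of z] by linarith
  with z show "cmod (exp (v z)) \<le> 1 / (1 - cmod z) ^ (2 * p)" "1 / (1 + cmod z) ^ (2 * p) \<le> cmod (exp (v z))"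
    using starlike_factor_bounds[OF z] by (simp_all flip: E)
qed

text \<open>The half-plane estimate is applied to \<open>h - \<gamma>\<close>, whose value at 0 is
  \<open>p - \<gamma>\<close>. Adding \<open>\<gamma>\<close> back uses the triangle inequality
  above and the real part below.\<close>

lemma h_bounds:
  assumes z: "cmod z < 1"
  shows "cmod (h z) \<le> (real p + (real p - 2 * \<gamma>) * cmod z) / (1 - cmod z)"
    and "(real p - (real p - 2 * \<gamma>) * cmod z) / (1 + cmod z) \<le> cmod (h z)"
proof -
  have hol: "(\<lambda>z. h z - of_real \<gamma>) holomorphic_on ball 0 1"
    by (intro holomorphic_intros h_hol)
  note b = Caratheodory_bounds[OF hol, of "real p - \<gamma>", simplified, OF _ _ z]
  have pos: "1 + cmod z > 0" using norm_ge_zero[of z] by linarith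
  have "cmod (h z) \<le> cmod (h z - of_real \<gamma>) + \<gamma>"
    using norm_triangle_sub[of "h z" "of_real \<gamma>"] \<gamma> by simp
  also have "\<dots> \<le> (real p - \<gamma>) * (1 + cmod z) / (1 - cmod z) + \<gamma>"
    using b(1) Re_h by (simp add: h_0)
  also have "\<dots> = (real p + (real p - 2 * \<gamma>) * cmod z) / (1 - cmod z)"
    using z by (simp add: field_simps)
  finally show "cmod (h z) \<le> (real p + (real p - 2 * \<gamma>) * cmod z) / (1 - cmod z)" .
  have "(real p - (real p - 2 * \<gamma>) * cmod z) / (1 + cmod z)
      = (real p - \<gamma>) * (1 - cmod z) / (1 + cmod z) + \<gamma>"
    using pos by (simp add: field_simps)
  also have "\<dots> \<le> Re (h z)"
    using b(2) Re_h by (simp add: h_0)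
  also have "\<dots> \<le> cmod (h z)" by (rule complex_Re_le_cmod)
  finally show "(real p - (real p - 2 * \<gamma>) * cmod z) / (1 + cmod z) \<le> cmod (h z)" .
qed

section \<open>Distortion and growth bounds\<close>

definition lower :: "real \<Rightarrow> real" where
  "lower \<tau> = (real p - (real p - 2 * \<gamma>) * \<tau>) * \<tau> ^ (p - 1) / (1 + \<tau>) ^ (2 * p + 1)"

definition upper :: "real \<Rightarrow> real" where
  "upper \<tau> = (real p + (real p - 2 * \<gamma>) * \<tau>) * \<tau> ^ (p - 1) / (1 - \<tau>) ^ (2 * p + 1)"

lemma linear_factor_pos:
  assumes "0 \<le> \<tau>" "\<tau> < 1"
  shows "0 < real p - (real p - 2 * \<gamma>) * \<tau>"
proof -
  have "(real p - 2 * \<gamma>) * \<tau> \<le> real p * \<tau>"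
    using \<gamma> assms by (intro mult_right_mono) auto
  also have "\<dots> < real p * 1"
    using p_pos assms by (intro mult_strict_left_mono) auto
  finally show ?thesis by simp
qed

text \<open>The factors of z^(p-1) exp(v) h are estimated separately. Multiplying the lower
  estimates relies on \<open>linear_factor_pos\<close>.\<close>

lemma deriv_f_bounds:
  assumes z: "cmod z < 1"
  shows "lower (cmod z) \<le> cmod (deriv f z)" and "cmod (deriv f z) \<le> upper (cmod z)"
proof -
  have D: "cmod (deriv f z) = cmod z ^ (p - 1) * (cmod (exp (v z)) * cmod (h z))"
    using deriv_f[of z] z by (simp add: norm_mult norm_power)
  have pos: "1 + cmod z > 0" using norm_ge_zero[of z] by linarith
  have "1 / (1 + cmod z) ^ (2 * p) * ((real p - (real p - 2 * \<gamma>) * cmod z) / (1 + cmod z))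
      \<le> cmod (exp (v z)) * cmod (h z)"
    using exp_v_bounds(2)[OF z] h_bounds(2)[OF z] linear_factor_pos[of "cmod z"] z pos
    by (intro mult_mono) auto
  from mult_left_mono[OF this, of "cmod z ^ (p - 1)"]
  show "lower (cmod z) \<le> cmod (deriv f z)"
    unfolding D lower_def by (simp add: mult_ac)
  have "cmod (exp (v z)) * cmod (h z)
      \<le> 1 / (1 - cmod z) ^ (2 * p) * ((real p + (real p - 2 * \<gamma>) * cmod z) / (1 - cmod z))"
    using exp_v_bounds(1)[OF z] h_bounds(1)[OF z] z by (intro mult_mono) auto
  from mult_left_mono[OF this, of "cmod z ^ (p - 1)"]
  show "cmod (deriv f z) \<le> upper (cmod z)"
    unfolding D upper_def by (simp add: mult_ac)
qed

lemma lower_continuous: "continuous_on {0..1} lower"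
  unfolding lower_def by (intro continuous_intros) auto

lemma upper_continuous: "b < 1 \<Longrightarrow> continuous_on {0..b} upper"
  unfolding upper_def by (intro continuous_intros) auto

lemma f_lower_bound:
  assumes z: "cmod z < 1"
  shows "integral {0..cmod z} lower \<le> cmod (f z)"
proof (rule cmod_f_ge[OF z])
  have "continuous_on {0..cmod z} lower"
    using lower_continuous z by (auto elim: continuous_on_subset)
  then show "continuous_on {0..cmod z} (\<lambda>t. integral {0..t} lower)"
    by (intro indefinite_integral_continuous_1 integrable_continuous_real)
  show "((\<lambda>t. integral {0..t} lower) has_real_derivative lower r) (at r)" if "0 < r" "r < 1" for r
    using has_real_derivative_integral_upper[OF lower_continuous that] .
  show "lower r > 0" if "0 < r" "r < 1" for r
    unfolding lower_def using linear_factor_pos[of r] that by (intro divide_pos_pos mult_pos_pos) auto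
qed (auto intro: deriv_f_bounds)

text \<open>Since f(0) = 0, it suffices to integrate the bound for |f'| along the ray from 0 to
  \<open>z\<close>, whose direction is \<open>u\<close>.\<close>

lemma f_upper_bound:
  assumes z: "cmod z < 1"
  shows "cmod (f z) \<le> integral {0..cmod z} upper"
proof (cases "z = 0")
  case True
  then show ?thesis by (simp add: f_0)
next
  case False
  define u where "u = sgn z"
  have u: "cmod u = 1" using False by (simp add: u_def norm_sgn)
  have zu: "of_real (cmod z) * u = z"
    using False by (simp add: u_def sgn_div_norm scaleR_conv_of_real)
  obtain b where b: "cmod z < b" "b < 1" using z dense by blast
  have D: "((\<lambda>t. f (of_real t * u)) has_vector_derivative u * deriv f (of_real t * u)) (at t)"
    if "\<bar>t\<bar> < 1" for t
  proof -
    have "((\<lambda>s. of_real s * u) has_vector_derivative u) (at t)"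
      by (rule has_vector_derivative_eq_rhs[OF has_vector_derivative_real_field[where f = "\<lambda>s. s * u" and f' = u]])
         (auto intro!: derivative_eq_intros)
    moreover have "(f has_field_derivative deriv f (of_real t * u)) (at (of_real t * u))"
      using holomorphic_derivI[OF f_hol open_ball] that u by (simp add: norm_mult)
    ultimately show ?thesis
      by (rule field_vector_diff_chain_at[unfolded o_def])
  qed
  have "norm (f (of_real (cmod z) * u) - f (of_real 0 * u))
      \<le> integral {0..cmod z} upper - integral {0..0} upper"
  proof (rule differentiable_bound_general[where f = "\<lambda>t. f (of_real t * u)" and \<phi> = "\<lambda>t. integral {0..t} upper"])
    show "continuous_on {0..cmod z} (\<lambda>t. f (of_real t * u))"
      using z by (intro continuous_at_imp_continuous_on ballI has_vector_derivative_continuous[OF D]) auto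
    show "continuous_on {0..cmod z} (\<lambda>t. integral {0..t} upper)"
      by (intro indefinite_integral_continuous_1 integrable_continuous_real upper_continuous z)
    fix t assume t: "0 < t" "t < cmod z"
    show "((\<lambda>t. integral {0..t} upper) has_vector_derivative upper t) (at t)"
      using has_real_derivative_integral_upper[OF upper_continuous[OF b(2)], of t] t b
      by (simp add: has_real_derivative_iff_has_vector_derivative)
    show "((\<lambda>t. f (of_real t * u)) has_vector_derivative u * deriv f (of_real t * u)) (at t)"
      using D t z by simp
    show "norm (u * deriv f (of_real t * u)) \<le> upper t"
      using deriv_f_bounds(2)[of "of_real t * u"] t z u by (simp add: norm_mult)
  qed (use False in auto)
  then show ?thesis unfolding zu by (simp add: f_0)
qed

end

subsection \<open>The classes of the theorem\<close>

text \<open>Dividing the series by z^p leaves a power series with constant term 1, which is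
  holomorphic also at the origin.\<close>

lemma class_A_factor:
  assumes "f \<in> class_A p"
  obtains f1 where "f1 holomorphic_on ball 0 1" "f1 0 = 1"
    "\<And>z. z \<in> ball 0 1 \<Longrightarrow> f z = z ^ p * f1 z"
proof -
  obtain a where a: "\<And>z. z \<in> ball 0 1 \<Longrightarrow> (\<lambda>n. a (Suc n + p) * z ^ (Suc n + p)) sums (f z - z ^ p)"
    using assms unfolding class_A_def by blast
  define b where "b = (\<lambda>n. if n = 0 then 1 else a (n + p))"
  define f1 where "f1 = (\<lambda>z. if z = 0 then 1 else f z / z ^ p)"
  have "(\<lambda>n. b n * (z - 0) ^ n) sums f1 z" if z: "z \<in> ball 0 1" for z
  proof (cases "z = 0")
    case True
    then show ?thesis using powser_sums_zero[of b] by (simp add: f1_def b_def)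
  next
    case False
    have "(\<lambda>n. a (Suc n + p) * z ^ (Suc n + p) / z ^ p) sums ((f z - z ^ p) / z ^ p)"
      by (intro sums_divide a z)
    also have "(\<lambda>n. a (Suc n + p) * z ^ (Suc n + p) / z ^ p) = (\<lambda>n. b (Suc n) * z ^ Suc n)"
      using False by (simp add: fun_eq_iff b_def power_add)
    also have "(f z - z ^ p) / z ^ p = f1 z - b 0 * z ^ 0"
      using False by (simp add: f1_def b_def diff_divide_distrib)
    finally show ?thesis
      using sums_Suc_iff[of "\<lambda>n. b n * z ^ n" "f1 z - b 0 * z ^ 0"] by simp
  qed
  then have "f1 holomorphic_on ball 0 1" by (rule power_series_holomorphic)
  moreover have "f z = z ^ p * f1 z" if z: "z \<in> ball 0 1" for z
  proof (cases "z = 0")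
    case True
    \<comment> \<open>At the origin every term of the series vanishes, so \<open>f 0\<close> is
      \<open>0 ^ p\<close>.\<close>
    have "(\<lambda>n. 0) sums (f 0 - 0 ^ p)" using a[of 0] by simp
    then have "f 0 - 0 ^ p = 0" using sums_unique2 sums_zero by blast
    then show ?thesis using True by (simp add: f1_def)
  qed (simp add: f1_def)
  moreover have "f1 0 = 1" by (simp add: f1_def)
  ultimately show ?thesis using that by blast
qed

lemma power_times_exp_deriv:
  assumes "p \<ge> 1" "(v has_field_derivative v') (at z)" and z: "z \<in> ball 0 1"
    and g: "\<And>z. z \<in> ball 0 1 \<Longrightarrow> g z = z ^ p * exp (v z)"
  shows "(g has_field_derivative z ^ (p - 1) * exp (v z) * (of_nat p + z * v')) (at z)"
proof -
  have zp: "z ^ p = z * z ^ (p - 1)" using assms(1) by (cases p) auto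
  have "((\<lambda>z. z ^ p * exp (v z)) has_field_derivative z ^ (p - 1) * exp (v z) * (of_nat p + z * v')) (at z)"
    by (rule derivative_eq_intros assms(2) refl)+ (simp add: zp algebra_simps)
  then show ?thesis
    by (rule has_field_derivative_transform_within_open[OF _ open_ball z]) (simp add: g)
qed

text \<open>g / z^p has no zeros in the disc and hence has a holomorphic logarithm \<open>v\<close>
  there; then z g' / g = p + z v'.\<close>

lemma starlike_class_exp:
  assumes g: "g \<in> starlike_class p \<alpha>" and p: "p \<ge> 1" and \<alpha>: "0 \<le> \<alpha>" "\<alpha> < real p"
  obtains v where "v holomorphic_on ball 0 1" "v 0 = 0"
    "\<And>z. z \<in> ball 0 1 \<Longrightarrow> g z = z ^ p * exp (v z)"
    "\<And>z. z \<in> ball 0 1 \<Longrightarrow> Re (of_nat p + z * deriv v z) > \<alpha>"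
proof -
  obtain g1 where g1: "g1 holomorphic_on ball 0 1" "g1 0 = 1"
      "\<And>z. z \<in> ball 0 1 \<Longrightarrow> g z = z ^ p * g1 z"
    using g class_A_factor unfolding starlike_class_def by blast
  have Re: "Re (z * deriv g z / g z) > \<alpha>" if "z \<in> ball 0 1" "z \<noteq> 0" for z
    using g that unfolding starlike_class_def fill0_def by (auto split: if_splits)
  \<comment> \<open>At a zero of \<open>g\<close> other than the origin the quotient would be 0, as
    division by 0 gives 0, and 0 is not greater than \<alpha>.\<close>
  have nz: "g1 z \<noteq> 0" if "z \<in> ball 0 1" for z
    using Re[OF that] g1(2,3) that \<alpha> by (cases "z = 0") auto
  obtain v0 where v0: "v0 holomorphic_on ball 0 1" "\<And>z. z \<in> ball 0 1 \<Longrightarrow> exp (v0 z) = g1 z"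
    using holomorphic_logarithm_exists[OF convex_ball open_ball g1(1) nz] by (metis centre_in_ball zero_less_one)
  \<comment> \<open>The shift gives \<open>v 0 = 0\<close> and leaves the exponential unchanged,
    because \<open>exp (v0 0) = g1 0 = 1\<close>.\<close>
  define v where "v = (\<lambda>z. v0 z - v0 0)"
  have v: "v holomorphic_on ball 0 1" "v 0 = 0"
    unfolding v_def by (auto intro!: holomorphic_intros v0)
  have gv: "g z = z ^ p * exp (v z)" if "z \<in> ball 0 1" for z
    using v0(2)[of 0] v0(2)[OF that] g1 that by (simp add: v_def exp_diff)
  have "Re (of_nat p + z * deriv v z) > \<alpha>" if z: "z \<in> ball 0 1" for z
  proof (cases "z = 0")
    case False
    have "deriv g z = z ^ (p - 1) * exp (v z) * (of_nat p + z * deriv v z)"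
      using power_times_exp_deriv[OF p holomorphic_derivI[OF v(1) open_ball z] z gv] DERIV_imp_deriv by blast
    moreover have "z ^ p = z * z ^ (p - 1)" using p by (cases p) auto
    ultimately have "z * deriv g z / g z = of_nat p + z * deriv v z"
      using False z by (simp add: gv)
    then show ?thesis using Re[OF z False] by simp
  qed (use \<alpha> in simp)
  then show ?thesis using that v gv by blast
qed

text \<open>Each rotated factor is z^p exp(v(\<epsilon>^\<nu> z)), as the powers of \<epsilon>
  cancel, so the exponents add up. The order (k-1)p/k is what keeps the sum starlike: dividing the
  product by z^((k-1)p) leaves a \<open>p\<close>-valently starlike function.\<close>

lemma sym_prod_exp:
  fixes k p :: nat
  assumes k: "k \<ge> 1" and p: "p \<ge> 1" and g: "g \<in> starlike_class p ((real k - 1) * real p / real k)"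
  obtains v where "v holomorphic_on ball 0 1" "v 0 = 0"
    "\<And>z. z \<in> ball 0 1 \<Longrightarrow> sym_prod p k g z = z ^ (k * p) * exp (v z)"
    "\<And>z. z \<in> ball 0 1 \<Longrightarrow> Re (of_nat p + z * deriv v z) > 0"
proof -
  define \<alpha> where "\<alpha> = (real k - 1) * real p / real k"
  have \<alpha>: "0 \<le> \<alpha>" "\<alpha> < real p" "real k * \<alpha> = (real k - 1) * real p"
    using k p by (auto simp: \<alpha>_def field_simps)
  obtain v where v: "v holomorphic_on ball 0 1" "v 0 = 0"
    "\<And>z. z \<in> ball 0 1 \<Longrightarrow> g z = z ^ p * exp (v z)"
    "\<And>z. z \<in> ball 0 1 \<Longrightarrow> Re (of_nat p + z * deriv v z) > \<alpha>"
    using starlike_class_exp[OF g[folded \<alpha>_def] p \<alpha>(1,2)] by blast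
  define \<epsilon> where "\<epsilon> = exp (2 * of_real pi * \<i> / of_nat k)"
  have \<epsilon>: "cmod \<epsilon> = 1" "\<epsilon> \<noteq> 0" by (simp_all add: \<epsilon>_def)
  have ball: "\<epsilon> ^ \<nu> * z \<in> ball 0 1" if "z \<in> ball 0 1" for \<nu> z
    using that by (simp add: norm_mult norm_power \<epsilon>)
  define u where "u = (\<lambda>z. \<Sum>\<nu><k. v (\<epsilon> ^ \<nu> * z))"
  have du: "(u has_field_derivative (\<Sum>\<nu><k. deriv v (\<epsilon> ^ \<nu> * z) * \<epsilon> ^ \<nu>)) (at z)" if z: "z \<in> ball 0 1" for z
    unfolding u_def
  proof (rule DERIV_sum)
    fix \<nu>
    show "((\<lambda>z. v (\<epsilon> ^ \<nu> * z)) has_field_derivative deriv v (\<epsilon> ^ \<nu> * z) * \<epsilon> ^ \<nu>) (at z)"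
      by (rule DERIV_chain2[where f = v and g = "\<lambda>z. \<epsilon> ^ \<nu> * z", OF holomorphic_derivI[OF v(1) open_ball ball[OF z, of \<nu>]]])
         (auto intro!: derivative_eq_intros)
  qed
  have "u holomorphic_on ball 0 1" using du holomorphic_on_open by blast
  moreover have "u 0 = 0" by (simp add: u_def v)
  moreover have "sym_prod p k g z = z ^ (k * p) * exp (u z)" if z: "z \<in> ball 0 1" for z
  proof -
    have "sym_prod p k g z = (\<Prod>\<nu><k. z ^ p * exp (v (\<epsilon> ^ \<nu> * z)))"
      unfolding sym_prod_def Let_def \<epsilon>_def[symmetric]
    proof (rule prod.cong)
      fix \<nu>
      have "\<epsilon> powi (- int (\<nu> * p)) = inverse (\<epsilon> ^ (\<nu> * p))"
        by (simp only: power_int_minus power_int_of_nat)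
      moreover have "(\<epsilon> ^ \<nu> * z) ^ p = \<epsilon> ^ (\<nu> * p) * z ^ p"
        by (simp only: power_mult_distrib power_mult)
      ultimately have "\<epsilon> powi (- int (\<nu> * p)) * (\<epsilon> ^ \<nu> * z) ^ p = z ^ p"
        using \<epsilon>(2) by simp
      then show "\<epsilon> powi (- int (\<nu> * p)) * g (\<epsilon> ^ \<nu> * z) = z ^ p * exp (v (\<epsilon> ^ \<nu> * z))"
        unfolding v(3)[OF ball[OF z]] mult.assoc[symmetric] by simp
    qed simp
    then show ?thesis
      by (simp add: prod.distrib u_def exp_sum mult.commute[of k p] flip: power_mult)
  qed
  moreover have "Re (of_nat p + z * deriv u z) > 0" if z: "z \<in> ball 0 1" for z
  proof -
    \<comment> \<open>The left side is k\<alpha> - kp = -p.\<close>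
    have "(\<Sum>\<nu><k. \<alpha> - real p) < (\<Sum>\<nu><k. Re (\<epsilon> ^ \<nu> * z * deriv v (\<epsilon> ^ \<nu> * z)))"
      using v(4)[OF ball[OF z]] k by (intro sum_strict_mono) (auto simp: diff_less_eq add.commute lessThan_empty_iff)
    also have "\<dots> = Re (z * deriv u z)"
      unfolding DERIV_imp_deriv[OF du[OF z]] by (simp add: sum_distrib_left Re_sum mult_ac)
    finally show ?thesis using \<alpha>(3) by (simp add: algebra_simps)
  qed
  ultimately show ?thesis using that by blast
qed

text \<open>The exponent \<open>v\<close> of the symmetrized product defines G = z^p exp(v), and the
  quotient in the definition of the class becomes z f' / G.\<close>

lemma class_K_close_to_convex:
  assumes p: "p \<ge> 1" and k: "k \<ge> 1" and \<gamma>: "0 \<le> \<gamma>" "\<gamma> < real p" and f: "f \<in> class_K k \<gamma> p"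
  obtains f1 v h where "close_to_convex p \<gamma> f f1 v h"
proof -
  obtain f1 where f1: "f1 holomorphic_on ball 0 1" "f1 0 = 1"
      "\<And>z. z \<in> ball 0 1 \<Longrightarrow> f z = z ^ p * f1 z"
    using f class_A_factor unfolding class_K_def by blast
  obtain g where g: "g \<in> starlike_class p ((real k - 1) * real p / real k)"
    and Re: "\<And>z. z \<in> ball 0 1 \<Longrightarrow> Re (fill0 (\<lambda>w. w ^ ((k - 1) * p + 1) * deriv f w / sym_prod p k g w) z) > \<gamma>"
    using f unfolding class_K_def by blast
  obtain v where v: "v holomorphic_on ball 0 1" "v 0 = 0"
    "\<And>z. z \<in> ball 0 1 \<Longrightarrow> sym_prod p k g z = z ^ (k * p) * exp (v z)"
    "\<And>z. z \<in> ball 0 1 \<Longrightarrow> Re (of_nat p + z * deriv v z) > 0"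
    using sym_prod_exp[OF k p g] by blast
  \<comment> \<open>This is z f' / G with z^p cancelled, hence holomorphic at 0 with value
    \<open>p\<close>.\<close>
  define h where "h = (\<lambda>z. (of_nat p * f1 z + z * deriv f1 z) / exp (v z))"
  have df: "(f has_field_derivative z ^ (p - 1) * exp (v z) * h z) (at z)" if z: "z \<in> ball 0 1" for z
  proof -
    have zp: "z ^ p = z * z ^ (p - 1)" using p by (cases p) auto
    have "((\<lambda>z. z ^ p * f1 z) has_field_derivative z ^ (p - 1) * (of_nat p * f1 z + z * deriv f1 z)) (at z)"
      by (rule derivative_eq_intros holomorphic_derivI[OF f1(1) open_ball z] refl)+
         (simp add: zp algebra_simps)
    also have "z ^ (p - 1) * (of_nat p * f1 z + z * deriv f1 z) = z ^ (p - 1) * exp (v z) * h z"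
      by (simp add: h_def)
    finally have "((\<lambda>z. z ^ p * f1 z) has_field_derivative z ^ (p - 1) * exp (v z) * h z) (at z)" .
    then show ?thesis
      by (rule has_field_derivative_transform_within_open[OF _ open_ball z]) (simp add: f1)
  qed
  have "close_to_convex p \<gamma> f f1 v h"
  proof
    show "h holomorphic_on ball 0 1"
      unfolding h_def by (intro holomorphic_intros holomorphic_deriv f1 v open_ball) auto
    show "h 0 = of_nat p" by (simp add: h_def f1 v)
    show "Re (h z) > \<gamma>" if z: "z \<in> ball 0 1" for z
    proof (cases "z = 0")
      case True
      then show ?thesis using \<gamma> by (simp add: h_def f1 v)
    next
      case False
      \<comment> \<open>The powers of z from the numerator and from f' match those of the
        symmetrized product exactly.\<close>
      have "(k - 1) * p + 1 + (p - 1) = k * p"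
        using p k by (cases k) auto
      then have "z ^ (k * p) = z ^ ((k - 1) * p + 1) * z ^ (p - 1)"
        by (metis power_add)
      then have "z ^ ((k - 1) * p + 1) * deriv f z / sym_prod p k g z = h z"
        unfolding v(3)[OF z] DERIV_imp_deriv[OF df[OF z]] using False by simp
      then show ?thesis using Re[OF z] False by (simp add: fill0_def)
    qed
  qed (fact p \<gamma> f1 v df)+
  then show ?thesis by (rule that)
qed

theorem theorem5:
  fixes p k :: nat and \<gamma> r :: real and f :: "complex \<Rightarrow> complex" and z :: complex
  assumes "p \<ge> 1" and "k \<ge> 1"
    and "0 \<le> \<gamma>" and "\<gamma> < real p"
    and "f \<in> class_K k \<gamma> p"
    and "cmod z = r" and "0 \<le> r" and "r < 1"
  shows "((real p - (real p - 2 * \<gamma>) * r) * r ^ (p - 1) / (1 + r) ^ (2 * p + 1) \<le> cmod (deriv f z) \<and>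
          cmod (deriv f z) \<le> (real p + (real p - 2 * \<gamma>) * r) * r ^ (p - 1) / (1 - r) ^ (2 * p + 1)) \<and>
         (integral {0..r} (\<lambda>\<tau>. (real p - (real p - 2 * \<gamma>) * \<tau>) * \<tau> ^ (p - 1) / (1 + \<tau>) ^ (2 * p + 1)) \<le> cmod (f z) \<and>
          cmod (f z) \<le> integral {0..r} (\<lambda>\<tau>. (real p + (real p - 2 * \<gamma>) * \<tau>) * \<tau> ^ (p - 1) / (1 - \<tau>) ^ (2 * p + 1)))"
proof -
  obtain f1 v h where "close_to_convex p \<gamma> f f1 v h"
    using class_K_close_to_convex[OF assms(1-5)] by blast
  then interpret close_to_convex p \<gamma> f f1 v h .
  have z: "cmod z < 1" using assms by simp
  show ?thesis
    using deriv_f_bounds[OF z] f_lower_bound[OF z] f_upper_bound[OF z]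
    unfolding lower_def[abs_def] upper_def[abs_def] \<open>cmod z = r\<close> by simp
qed

end
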